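(* $\frac34 n \leq \text{SC}_2(\mathcal{G}_{\mathrm{hex}}, 3)$.
   Context: An $s$-of-$k$ game on a $k$-uniform hypergraph $(V,\mathcal F)$ with $s\in\{1,\dots,k\}$: Maker and Breaker alternately claim unclaimed vertices (Maker first) until all are claimed; a winning set is good if Maker claimed at least $s$ of its elements. Maker maximizes, Breaker minimizes the number of good winning sets. $\text{SC}(\mathcal G,s)$ is this number under optimal play; $\text{SC}_2(\mathcal G,s)$ is the same when Maker is restricted to a pairing strategy (vertices paired in advance into disjoint pairs, Maker always answers Breaker's move by claiming the paired vertex). $\mathcal{G}_{\mathrm{hex}}$ denotes the game played on the vertices of a large finite two-dimensional hexagonal grid whose winning sets are all hexagons (so $k=6$); $n$ is the number of hexagons, and bounds are up to an $o(n)$ boundary error term. *)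

theory Defs
  imports Complex_Main "HOL-Library.Landau_Symbols"
begin

type_synonym 'a hypergraph = "'a set \<times> 'a set set"

definition uniform :: "nat \<Rightarrow> 'a hypergraph \<Rightarrow> bool" where
  "uniform k G \<longleftrightarrow> finite (fst G) \<and> (\<forall>S\<in>snd G. S \<subseteq> fst G \<and> card S = k)"

text \<open>
  A history is the list of the vertices claimed so far, in order of play. Maker moves first, so the
  moves at the even positions \<open>0, 2, \<dots>\<close> are Maker's.
\<close>

definition full_play :: "'a hypergraph \<Rightarrow> 'a list \<Rightarrow> bool" where
  "full_play G xs \<longleftrightarrow> distinct xs \<and> set xs = fst G"

definition maker_to_move :: "'a hypergraph \<Rightarrow> 'a list \<Rightarrow> bool" where
  "maker_to_move G h \<longleftrightarrow> distinct h \<and> set h \<subset> fst G \<and> even (length h)"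

definition maker_claims :: "'a list \<Rightarrow> 'a set" where
  "maker_claims xs = {xs ! i | i. i < length xs \<and> even i}"

definition num_good :: "'a hypergraph \<Rightarrow> nat \<Rightarrow> 'a set \<Rightarrow> nat" where
  "num_good G s M = card {S \<in> snd G. s \<le> card (S \<inter> M)}"

definition maker_strategy :: "'a hypergraph \<Rightarrow> ('a list \<Rightarrow> 'a) \<Rightarrow> bool" where
  "maker_strategy G \<sigma> \<longleftrightarrow> (\<forall>h. maker_to_move G h \<longrightarrow> \<sigma> h \<in> fst G - set h)"

definition consistent :: "('a list \<Rightarrow> 'a) \<Rightarrow> 'a list \<Rightarrow> bool" where
  "consistent \<sigma> xs \<longleftrightarrow> (\<forall>i<length xs. even i \<longrightarrow> xs ! i = \<sigma> (take i xs))"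

text \<open>
  The outcome of a Maker strategy against best play by Breaker. For a finite hypergraph and a
  legal strategy the set below is finite and nonempty.
\<close>

definition strategy_value :: "'a hypergraph \<Rightarrow> nat \<Rightarrow> ('a list \<Rightarrow> 'a) \<Rightarrow> nat" where
  "strategy_value G s \<sigma> =
     Min {num_good G s (maker_claims xs) | xs. full_play G xs \<and> consistent \<sigma> xs}"

definition SC :: "'a hypergraph \<Rightarrow> nat \<Rightarrow> nat" where
  "SC G s = Max {strategy_value G s \<sigma> | \<sigma>. maker_strategy G \<sigma>}"

text \<open>
  All vertices are paired, except for a single one if their number is odd. Partial pairings must
  be excluded: with the empty pairing, every strategy would count as a pairing strategy.
\<close>

definition pairing :: "'a hypergraph \<Rightarrow> 'a set set \<Rightarrow> bool" where
  "pairing G P \<longleftrightarrow>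
     (\<forall>p\<in>P. p \<subseteq> fst G \<and> card p = 2) \<and> pairwise disjnt P \<and> card (fst G - \<Union>P) \<le> 1"

text \<open>
  Maker answers Breaker's last move \<open>v\<close> with its partner \<open>w\<close>. Only where this is impossible, namely
  on the opening move and when \<open>v\<close> has no partner or its partner is already claimed, is Maker free
  to claim any remaining vertex.
\<close>

definition pairing_strategy :: "'a hypergraph \<Rightarrow> 'a set set \<Rightarrow> ('a list \<Rightarrow> 'a) \<Rightarrow> bool" where
  "pairing_strategy G P \<sigma> \<longleftrightarrow> maker_strategy G \<sigma> \<and>
     (\<forall>h v w. maker_to_move G (h @ [v]) \<and> {v, w} \<in> P \<and> w \<notin> set h \<longrightarrow> \<sigma> (h @ [v]) = w)"

definition SC2 :: "'a hypergraph \<Rightarrow> nat \<Rightarrow> nat" where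
  "SC2 G s = Max {strategy_value G s \<sigma> | \<sigma> P. pairing G P \<and> pairing_strategy G P \<sigma>}"

text \<open>
  The pair \<open>(x, y)\<close> stands for the point \<open>x + y \<omega>\<close> of the plane with \<open>\<omega> = exp (i \<pi> / 3)\<close>. The
  triangular lattice of all these points splits into the centres of the cells of the hexagonal
  tiling with edge length 1 (a sublattice of index 3) and the vertices of that tiling. A hexagon is
  its centre plus the six powers of \<open>\<omega>\<close>.
\<close>

definition hex_centres :: "(int \<times> int) set" where
  "hex_centres = {(x, y). 3 dvd (x - y)}"

definition hex_vertices :: "(int \<times> int) set" where
  "hex_vertices = - hex_centres"

definition hexagon :: "int \<times> int \<Rightarrow> (int \<times> int) set" where
  "hexagon = (\<lambda>(x, y).
     {(x + 1, y), (x, y + 1), (x - 1, y + 1), (x - 1, y), (x, y - 1), (x + 1, y - 1)})"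

text \<open>A finite hexagonal grid is given by its vertex set \<open>V\<close>.\<close>

definition hexagons_in :: "(int \<times> int) set \<Rightarrow> (int \<times> int) set set" where
  "hexagons_in V = {hexagon c | c. c \<in> hex_centres \<and> hexagon c \<subseteq> V}"

definition hex_game :: "(int \<times> int) set \<Rightarrow> (int \<times> int) hypergraph" where
  "hex_game V = (V, hexagons_in V)"

text \<open>
  The vertices of the grid for which one of the three cells of the tiling around them is missing.
\<close>

definition hex_boundary :: "(int \<times> int) set \<Rightarrow> (int \<times> int) set" where
  "hex_boundary V = {v \<in> V. \<exists>c\<in>hex_centres. v \<in> hexagon c \<and> \<not> hexagon c \<subseteq> V}"

lemma hexagon_subset_hex_vertices: "c \<in> hex_centres \<Longrightarrow> hexagon c \<subseteq> hex_vertices"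
  by (cases c) (auto simp: hexagon_def hex_vertices_def hex_centres_def, presburger+)

lemma uniform_hex_game: "finite V \<Longrightarrow> uniform 6 (hex_game V)"
  by (auto simp: uniform_def hex_game_def hexagons_in_def hexagon_def split: prod.splits)

end

theory Submission imports Defs begin

text \<open>
  Colour the cells of the tiling with three colours so that adjacent cells get different colours,
  and pair the two ends of every edge between a cell of colour 1 and a cell of colour 2. Each cell
  of colour 1 or 2 contains three pairs, so Maker gets three of its vertices. The cells of colour 0
  are disjoint and Breaker needs four vertices to spoil one of them. Breaker claims at most half of
  the vertices, about \<open>n\<close> of them, and hence spoils about \<open>n / 4\<close> hexagons at most.
\<close>

section \<open>Pairing strategies\<close>

text \<open>Splitting off two vertices at a time leaves at most one. This serves to complete the
  geometric pairing, which may miss vertices whose partner lies outside the grid.\<close>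

lemma exists_pairing:
  assumes "finite A"
  shows "\<exists>P. pairing (A, E) P"
  using assms
proof (induction "card A" arbitrary: A rule: less_induct)
  case less
  show ?case
  proof (cases "card A \<le> 1")
    case True
    then have "pairing (A, E) {}" by (simp add: pairing_def)
    then show ?thesis ..
  next
    case False
    then obtain B where B: "B \<subseteq> A" "card B = 2"
      by (metis obtain_subset_with_card_n not_less_eq_eq numeral_2_eq_2 One_nat_def)
    have "card (A - B) < card A"
      using B less.prems False by (simp add: card_Diff_subset finite_subset)
    then obtain P where P: "pairing (A - B, E) P" using less by blast
    have "A - \<Union>(insert B P) = A - B - \<Union>P" by blast
    moreover have "disjnt B p" if "p \<in> P" for p
      using that P by (auto simp: pairing_def disjnt_def)
    ultimately have "pairing (A, E) (insert B P)"
      using P B by (auto simp: pairing_def pairwise_insert disjnt_sym)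
    then show ?thesis ..
  qed
qed

lemma pairing_Un:
  assumes P: "\<And>p. p \<in> P \<Longrightarrow> p \<subseteq> A \<and> card p = 2" "pairwise disjnt P"
    and Q: "pairing (A - \<Union>P, E) Q"
  shows "pairing (A, E) (P \<union> Q)"
proof -
  have "A - \<Union>(P \<union> Q) = A - \<Union>P - \<Union>Q" by blast
  moreover have "disjnt p q" if "p \<in> P" "q \<in> Q" for p q
    using that Q by (auto simp: pairing_def disjnt_def)
  moreover have "\<Union>P \<subseteq> A" using P(1) by blast
  ultimately show ?thesis
    using P Q unfolding pairing_def pairwise_def
    by (simp add: disjnt_sym ball_Un) (metis Diff_subset disjnt_sym order_trans)
qed

lemma pairing_partner_unique:
  assumes "pairing G P" "{v, w} \<in> P" "{v, w'} \<in> P"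
  shows "w = w'"
proof -
  have "\<not> disjnt {v, w} {v, w'}" by (simp add: disjnt_def)
  then have "{v, w} = {v, w'}"
    using assms unfolding pairing_def by (metis pairwiseD)
  then show ?thesis by (auto simp: doubleton_eq_iff)
qed

text \<open>The reply is forced only by a last move whose partner is free. Since partners are
  unique, at most one reply is forced, so the local condition \<open>ok\<close> can always be met
  and a choice function is a strategy.\<close>

lemma exists_pairing_strategy:
  assumes "pairing G P"
  shows "\<exists>\<sigma>. pairing_strategy G P \<sigma>"
proof -
  define ok where "ok = (\<lambda>h u. u \<in> fst G - set h \<and>
    (\<forall>g v w. h = g @ [v] \<and> {v, w} \<in> P \<and> w \<notin> set g \<longrightarrow> u = w))"
  have "\<exists>u. ok h u" if h: "maker_to_move G h" for h
  proof (cases "\<exists>g v w. h = g @ [v] \<and> {v, w} \<in> P \<and> w \<notin> set g")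
    case True
    then obtain g v w where gvw: "h = g @ [v]" "{v, w} \<in> P" "w \<notin> set g" by blast
    have "{v, w} \<subseteq> fst G" "card {v, w} = 2"
      using assms gvw(2) unfolding pairing_def by blast+
    then have "w \<in> fst G" "w \<noteq> v" by auto
    then have "ok h w"
      using gvw pairing_partner_unique[OF assms] by (auto simp: ok_def)
    then show ?thesis ..
  next
    case False
    obtain u where "u \<in> fst G - set h" using h by (auto simp: maker_to_move_def)
    then show ?thesis using False unfolding ok_def by metis
  qed
  then have "ok h (SOME u. ok h u)" if "maker_to_move G h" for h
    using that by (metis someI_ex)
  then have "pairing_strategy G P (\<lambda>h. SOME u. ok h u)"
    unfolding pairing_strategy_def maker_strategy_def ok_def by blast
  then show ?thesis by blast
qed

section \<open>Plays\<close>

text \<open>Extend a partial play vertex by vertex, following \<open>\<sigma>\<close> at even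
  lengths and moving freely at odd ones. This makes the set under \<open>Min\<close> in
  \<open>strategy_value\<close> nonempty.\<close>

lemma exists_consistent_full_play:
  assumes fin: "finite (fst G)" and \<sigma>: "maker_strategy G \<sigma>"
  shows "\<exists>xs. full_play G xs \<and> consistent \<sigma> xs"
proof -
  have "\<exists>xs. distinct xs \<and> set xs \<subseteq> fst G \<and> length xs = k \<and> consistent \<sigma> xs"
    if "k \<le> card (fst G)" for k
    using that
  proof (induction k)
    case 0
    then show ?case by (simp add: consistent_def)
  next
    case (Suc k)
    then obtain xs where xs: "distinct xs" "set xs \<subseteq> fst G" "length xs = k" "consistent \<sigma> xs"
      by auto
    have "set xs \<noteq> fst G"
      using xs Suc.prems by (metis distinct_card not_less_eq_eq order_refl)
    then have sub: "set xs \<subset> fst G" using xs by blast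
    obtain u where u: "u \<in> fst G - set xs" "even k \<longrightarrow> u = \<sigma> xs"
    proof (cases "even k")
      case True
      then have "maker_to_move G xs" using xs sub by (simp add: maker_to_move_def)
      then show ?thesis using \<sigma> that by (auto simp: maker_strategy_def)
    next
      case False
      then show ?thesis using sub that by blast
    qed
    have "consistent \<sigma> (xs @ [u])"
      using xs u by (auto simp: consistent_def nth_append less_Suc_eq)
    then show ?case using xs u by (intro exI[of _ "xs @ [u]"]) auto
  qed
  then obtain xs where xs: "distinct xs" "set xs \<subseteq> fst G" "length xs = card (fst G)" "consistent \<sigma> xs"
    by blast
  then have "set xs = fst G" using fin by (metis card_subset_eq distinct_card)
  then show ?thesis using xs by (auto simp: full_play_def)
qed

section \<open>From bounds on single plays to bounds on \<open>SC2\<close>\<close>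

lemma num_good_le: "finite (snd G) \<Longrightarrow> num_good G s M \<le> card (snd G)"
  unfolding num_good_def by (rule card_mono) auto

lemma finite_outcomes:
  assumes "finite (snd G)"
  shows "finite {num_good G s (maker_claims xs) | xs. full_play G xs \<and> consistent \<sigma> xs}"
  by (rule finite_subset[of _ "{..card (snd G)}"]) (auto simp: num_good_le[OF assms])

lemma SC2_geI:
  assumes fin: "finite (fst G)" "finite (snd G)" and P: "pairing G P" "pairing_strategy G P \<sigma>"
    and le: "\<And>xs. full_play G xs \<Longrightarrow> consistent \<sigma> xs \<Longrightarrow> N \<le> num_good G s (maker_claims xs)"
  shows "N \<le> SC2 G s"
proof -
  \<comment> \<open>There may be infinitely many strategies, but their values lie in a fixed finite
    set, so that \<open>Max\<close> in \<open>SC2\<close> is a genuine maximum.\<close>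
  have range: "strategy_value G s \<tau> \<in> {..card (snd G)}" if "maker_strategy G \<tau>" for \<tau>
  proof -
    let ?S = "{num_good G s (maker_claims xs) | xs. full_play G xs \<and> consistent \<tau> xs}"
    have "Min ?S \<in> ?S"
      using exists_consistent_full_play[OF fin(1) that] finite_outcomes[OF fin(2)]
      by (intro Min_in) auto
    then show ?thesis
      using num_good_le[OF fin(2)] by (auto simp: strategy_value_def)
  qed
  have "N \<le> strategy_value G s \<sigma>"
    unfolding strategy_value_def
    using exists_consistent_full_play[OF fin(1)] finite_outcomes[OF fin(2)] P le
    by (subst Min_ge_iff) (auto simp: pairing_strategy_def)
  also have "\<dots> \<le> SC2 G s"
    unfolding SC2_def
  proof (rule Max_ge)
    show "finite {strategy_value G s \<sigma> |\<sigma> P. pairing G P \<and> pairing_strategy G P \<sigma>}"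
      by (rule finite_subset[of _ "{..card (snd G)}"]) (use range in \<open>auto simp: pairing_strategy_def\<close>)
  qed (use P in blast)
  finally show ?thesis .
qed

text \<open>If Breaker held both vertices of a pair, then Maker would have answered the earlier of
  the two moves with the other vertex.\<close>

lemma pairing_strategy_claims:
  assumes \<sigma>: "pairing_strategy G P \<sigma>" and xs: "full_play G xs" "consistent \<sigma> xs"
    and vw: "{v, w} \<in> P" "v \<in> fst G" "w \<in> fst G" "v \<noteq> w"
  shows "v \<in> maker_claims xs \<or> w \<in> maker_claims xs"
proof (rule ccontr)
  assume contr: "\<not> ?thesis"
  have "v \<in> set xs" "w \<in> set xs" using xs vw by (auto simp: full_play_def)
  then obtain i j where ij: "i < length xs" "xs ! i = v" "j < length xs" "xs ! j = w"
    by (metis in_set_conv_nth)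
  \<comment> \<open>Breaker moves sit at odd positions. Taking \<open>i\<close> as the earlier one
    suffices, since the pair is unordered.\<close>
  have False if ij: "i < j" "j < length xs" "odd i" "odd j" "{xs ! i, xs ! j} \<in> P" for i j
  proof -
    have dist: "distinct xs" "set xs = fst G" using xs by (auto simp: full_play_def)
    have take: "take (Suc i) xs = take i xs @ [xs ! i]"
      using ij by (simp add: take_Suc_conv_app_nth)
    have notin: "xs ! j \<notin> set (take k xs)" if "k \<le> j" for k
      using that ij dist by (auto simp: in_set_conv_nth nth_eq_iff_index_eq)
    \<comment> \<open>The vertex \<open>xs ! j\<close> is still free after move \<open>i\<close>, so
      the play is not over and Maker has to move.\<close>
    have "set (take (Suc i) xs) \<subset> fst G"
      using notin[of "Suc i"] ij dist set_take_subset[of "Suc i" xs] nth_mem[of j xs]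
      by (auto simp: psubset_eq)
    then have "maker_to_move G (take i xs @ [xs ! i])"
      unfolding take[symmetric] maker_to_move_def using ij dist by auto
    then have "\<sigma> (take (Suc i) xs) = xs ! j"
      unfolding take using \<sigma> ij notin[of i] by (auto simp: pairing_strategy_def)
    moreover have "xs ! Suc i = \<sigma> (take (Suc i) xs)"
      using xs(2) ij by (auto simp: consistent_def)
    ultimately have "Suc i = j"
      using ij dist by (metis Suc_lessI nth_eq_iff_index_eq less_trans)
    then show False using ij(3,4) by presburger
  qed
  moreover have "odd i" "odd j" using contr ij by (auto simp: maker_claims_def)
  moreover have "i \<noteq> j" using ij vw by auto
  ultimately show False
    using ij vw(1) by (metis insert_commute linorder_neqE_nat)
qed

lemma card_breaker_claims:
  assumes "full_play G xs"
  shows "2 * card (fst G - maker_claims xs) \<le> card (fst G)"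
proof -
  have len: "length xs = card (fst G)"
    using assms by (metis distinct_card full_play_def)
  have "fst G - maker_claims xs \<subseteq> (\<lambda>k. xs ! (2 * k + 1)) ` {..<length xs div 2}"
  proof
    fix v assume v: "v \<in> fst G - maker_claims xs"
    then obtain i where i: "i < length xs" "xs ! i = v"
      using assms by (metis DiffD1 full_play_def in_set_conv_nth)
    then have "odd i" using v by (auto simp: maker_claims_def)
    then obtain k where "i = 2 * k + 1" by (rule oddE)
    then show "v \<in> (\<lambda>k. xs ! (2 * k + 1)) ` {..<length xs div 2}"
      using i by (auto intro!: image_eqI[of _ _ k])
  qed
  then have "card (fst G - maker_claims xs) \<le> length xs div 2"
    using surj_card_le[of "{..<length xs div 2}"] by (metis card_lessThan finite_lessThan)
  then show ?thesis using len by simp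
qed

section \<open>The hexagonal grid\<close>

text \<open>The centre is the barycentre of the six vertices, hence determined by the
  hexagon.\<close>

lemma sum_hexagon: "sum fst (hexagon (x, y)) = 6 * x" "sum snd (hexagon (x, y)) = 6 * y"
  by (simp_all add: hexagon_def)

lemma card_hexagon: "card (hexagon c) = 6"
  by (cases c) (simp add: hexagon_def)

lemma inj_hexagon: "inj hexagon"
proof (rule injI)
  fix c d assume "hexagon c = hexagon d"
  then show "c = d"
    using sum_hexagon[of "fst c" "snd c"] sum_hexagon[of "fst d" "snd d"] by (simp add: prod_eq_iff)
qed

text \<open>The tiling graph is bipartite with classes given by \<open>(x - y) mod 3\<close>; the
  offsets from a vertex to its three surrounding centres in one class are the negatives of those in
  the other.\<close>

lemma three_hexagons:
  assumes "v \<in> hex_vertices"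
  shows "\<exists>C. C \<subseteq> hex_centres \<and> card C = 3 \<and> (\<forall>c\<in>C. v \<in> hexagon c)"
proof -
  obtain x y where v: "v = (x, y)" by fastforce
  from assms have "(x - y) mod 3 = 1 \<or> (x - y) mod 3 = 2"
    by (auto simp: v hex_vertices_def hex_centres_def; presburger)
  then show ?thesis
  proof
    assume "(x - y) mod 3 = 1"
    then have "{(x - 1, y), (x, y + 1), (x + 1, y - 1)} \<subseteq> hex_centres"
      unfolding hex_centres_def by (simp; presburger)
    then show ?thesis
      by (intro exI[of _ "{(x - 1, y), (x, y + 1), (x + 1, y - 1)}"]) (auto simp: v hexagon_def)
  next
    assume "(x - y) mod 3 = 2"
    then have "{(x + 1, y), (x, y - 1), (x - 1, y + 1)} \<subseteq> hex_centres"
      unfolding hex_centres_def by (simp; presburger)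
    then show ?thesis
      by (intro exI[of _ "{(x + 1, y), (x, y - 1), (x - 1, y + 1)}"]) (auto simp: v hexagon_def)
  qed
qed

lemma finite_hexagons_in: "finite V \<Longrightarrow> finite (hexagons_in V)"
  by (rule finite_subset[of _ "Pow V"]) (auto simp: hexagons_in_def)

text \<open>Double counting of incidences: each inner vertex lies in three hexagons of the grid, and
  each hexagon has six vertices.\<close>

lemma card_grid_le:
  assumes fin: "finite V" and V: "V \<subseteq> hex_vertices"
  shows "card V \<le> 2 * card (hexagons_in V) + card (hex_boundary V)"
proof -
  let ?H = "hexagons_in V" and ?I = "V - hex_boundary V"
  have bd: "hex_boundary V \<subseteq> V" by (auto simp: hex_boundary_def)
  have three: "3 \<le> card {S \<in> ?H. v \<in> S}" if "v \<in> ?I" for v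
  proof -
    obtain C where C: "C \<subseteq> hex_centres" "card C = 3" "\<forall>c\<in>C. v \<in> hexagon c"
      using three_hexagons V \<open>v \<in> ?I\<close> by blast
    then have "hexagon ` C \<subseteq> {S \<in> ?H. v \<in> S}"
      using \<open>v \<in> ?I\<close> unfolding hexagons_in_def hex_boundary_def by blast
    then have "card (hexagon ` C) \<le> card {S \<in> ?H. v \<in> S}"
      using finite_hexagons_in[OF fin] by (intro card_mono) auto
    then show ?thesis
      using C card_image[OF inj_on_subset[OF inj_hexagon]] by simp
  qed
  have "3 * card ?I \<le> (\<Sum>v\<in>?I. card {S \<in> ?H. v \<in> S})"
    using sum_mono[of ?I "\<lambda>_. 3 :: nat"] three by (simp add: mult.commute)
  also have "\<dots> = (\<Sum>S\<in>?H. card {v \<in> ?I. v \<in> S})"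
    using sum.swap_restrict[of ?I ?H "\<lambda>_ _. 1 :: nat" "(\<in>)"] fin finite_hexagons_in[OF fin]
    by simp
  also have "\<dots> \<le> (\<Sum>S\<in>?H. 6)"
  proof (rule sum_mono)
    fix S assume "S \<in> ?H"
    then have S: "card S = 6" by (auto simp: hexagons_in_def card_hexagon)
    then have "finite S" by (auto intro: card_ge_0_finite)
    then show "card {v \<in> ?I. v \<in> S} \<le> 6" using S card_mono[of S "{v \<in> ?I. v \<in> S}"] by auto
  qed
  finally have "card ?I \<le> 2 * card ?H" by simp
  then show ?thesis
    using card_Diff_subset[OF finite_subset[OF bd fin] bd] by linarith
qed

section \<open>The pairing of the hexagonal grid\<close>

text \<open>
  The colour of a centre \<open>(x, y)\<close> is \<open>x mod 3\<close>, so the centres of colour 0 are the points with both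
  coordinates divisible by 3. Every vertex \<open>v\<close> is \<open>a + u\<close> with \<open>a\<close> of colour 0 and a unit \<open>u\<close>, namely
  the one whose coordinates are the residues of those of \<open>v\<close> in \<open>{- 1, 0, 1}\<close>; its partner is
  \<open>a + 2 u\<close>.
\<close>

definition residue3 :: "int \<Rightarrow> int" where
  "residue3 x = (x + 1) mod 3 - 1"

definition partner :: "int \<times> int \<Rightarrow> int \<times> int" where
  "partner = (\<lambda>(x, y). (x + residue3 x, y + residue3 y))"

lemma partner_involution: "partner (partner v) = v"
proof -
  \<comment> \<open>In other terms, \<open>a + 2 u = (a + 3 u) - u\<close>, where
    \<open>a + 3 u\<close> again has colour 0: the partner has the opposite unit.\<close>
  have "residue3 (z + residue3 z) = - residue3 z" for z
    unfolding residue3_def by presburger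
  then show ?thesis by (simp add: partner_def split: prod.splits)
qed

text \<open>A fixed point has both residues 0 and is thus a centre of colour 0.\<close>

lemma partner_neq: "v \<in> hex_vertices \<Longrightarrow> partner v \<noteq> v"
  by (cases v) (simp add: partner_def residue3_def hex_vertices_def hex_centres_def; presburger)

text \<open>Around a centre of colour 1 or 2 the map \<open>partner\<close> swaps the ends of every
  other edge of the hexagon; the two colours use complementary triples of edges.\<close>

lemma partner_in_hexagon:
  assumes "(x, y) \<in> hex_centres" "\<not> 3 dvd x" "v \<in> hexagon (x, y)"
  shows "partner v \<in> hexagon (x, y)"
proof -
  have r1: "residue3 z = 1" "residue3 (z + 1) = - 1" "residue3 (z - 1) = 0" if "z mod 3 = 1" for z
    using that unfolding residue3_def by presburger+
  have r2: "residue3 z = - 1" "residue3 (z + 1) = 0" "residue3 (z - 1) = 1" if "z mod 3 = 2" for z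
    using that unfolding residue3_def by presburger+
  have "x mod 3 = 1 \<and> y mod 3 = 1 \<or> x mod 3 = 2 \<and> y mod 3 = 2"
    using assms(1,2) unfolding hex_centres_def by (simp; presburger)
  then show ?thesis
  proof (elim disjE conjE)
    assume "x mod 3 = 1" "y mod 3 = 1"
    note r = r1[OF this(1)] r1[OF this(2)]
    show ?thesis
      using assms(3) unfolding hexagon_def prod.case
      by (elim insertE emptyE) (simp_all add: partner_def r)
  next
    assume "x mod 3 = 2" "y mod 3 = 2"
    note r = r2[OF this(1)] r2[OF this(2)]
    show ?thesis
      using assms(3) unfolding hexagon_def prod.case
      by (elim insertE emptyE) (simp_all add: partner_def r)
  qed
qed

text \<open>The centre of colour 0 is recovered from \<open>v\<close> by subtracting the residues of
  its coordinates.\<close>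

lemma hexagons_colour_0_disjoint:
  assumes "3 dvd x" "3 dvd y" "3 dvd x'" "3 dvd y'" "v \<in> hexagon (x, y)" "v \<in> hexagon (x', y')"
  shows "(x, y) = (x', y')"
proof -
  have centre: "(fst v - residue3 (fst v), snd v - residue3 (snd v)) = (x, y)"
    if "3 dvd x" "3 dvd y" "v \<in> hexagon (x, y)" for x y
    using that unfolding hexagon_def residue3_def by (auto; presburger)
  show ?thesis using centre assms by metis
qed

lemma exists_hex_pairing:
  assumes fin: "finite V" and V: "V \<subseteq> hex_vertices"
  shows "\<exists>P. pairing (hex_game V) P \<and> (\<forall>v\<in>V. partner v \<in> V \<longrightarrow> {v, partner v} \<in> P)"
proof -
  let ?P = "{{v, partner v} | v. v \<in> V \<and> partner v \<in> V}"
  obtain Q where Q: "pairing (V - \<Union>?P, hexagons_in V) Q"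
    using exists_pairing[OF finite_Diff[OF fin]] by blast
  have "pairwise disjnt ?P"
  proof (rule pairwiseI)
    fix p q assume "p \<in> ?P" "q \<in> ?P" "p \<noteq> q"
    then obtain v w where p: "p = {v, partner v}" and q: "q = {w, partner w}" by blast
    \<comment> \<open>As \<open>partner\<close> is an involution, either element determines the
      pair, so distinct pairs are disjoint.\<close>
    have eq: "{u, partner u} = {v, partner v}" if "u \<in> {v, partner v}" for u v
      using that partner_involution[of v] by auto
    show "disjnt p q"
      using \<open>p \<noteq> q\<close> eq unfolding p q disjnt_iff by metis
  qed
  moreover have "p \<subseteq> V \<and> card p = 2" if p: "p \<in> ?P" for p
  proof -
    obtain v where v: "p = {v, partner v}" "v \<in> V" "partner v \<in> V" using p by blast
    then have "partner v \<noteq> v" using partner_neq V by blast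
    then show ?thesis using v by simp
  qed
  ultimately have "pairing (hex_game V) (?P \<union> Q)"
    unfolding hex_game_def using Q by (intro pairing_Un) blast+
  then show ?thesis by blast
qed

section \<open>Counting the spoiled hexagons\<close>

lemma good_hexagon:
  assumes xy: "(x, y) \<in> hex_centres" "\<not> 3 dvd x"
    and M: "\<And>v. v \<in> hexagon (x, y) \<Longrightarrow> v \<in> M \<or> partner v \<in> M"
  shows "3 \<le> card (hexagon (x, y) \<inter> M)"
proof -
  let ?S = "hexagon (x, y)"
  have fin: "finite (?S \<inter> M)" by (simp add: hexagon_def)
  \<comment> \<open>The hexagon is closed under \<open>partner\<close>, so its claimed vertices and
    their partners cover it, whence 6 is at most twice the number claimed.\<close>
  have "?S \<subseteq> (?S \<inter> M) \<union> partner ` (?S \<inter> M)"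
  proof
    fix v assume v: "v \<in> ?S"
    then have "partner v \<in> ?S" using xy partner_in_hexagon by blast
    then show "v \<in> (?S \<inter> M) \<union> partner ` (?S \<inter> M)"
      using v M[OF v] partner_involution[of v] by (metis IntI UnCI image_eqI)
  qed
  then have "card ?S \<le> card ((?S \<inter> M) \<union> partner ` (?S \<inter> M))"
    using fin by (intro card_mono) auto
  also have "\<dots> \<le> card (?S \<inter> M) + card (partner ` (?S \<inter> M))" by (rule card_Un_le)
  also have "\<dots> \<le> card (?S \<inter> M) + card (?S \<inter> M)"
    using fin by (intro add_left_mono card_image_le)
  finally show ?thesis by (simp add: card_hexagon)
qed

text \<open>Spoiled hexagons have colour 0, so they are disjoint, and each has at least four of its
  six vertices outside \<open>M\<close>.\<close>

lemma card_bad_hexagons: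
  assumes fin: "finite V"
    and M: "\<And>v. v \<in> V \<Longrightarrow> partner v \<in> V \<Longrightarrow> v \<in> M \<or> partner v \<in> M"
  shows "4 * card {S \<in> hexagons_in V. card (S \<inter> M) < 3} \<le> card (V - M)"
proof -
  let ?bad = "{S \<in> hexagons_in V. card (S \<inter> M) < 3}"
  have bad: "\<exists>x y. S = hexagon (x, y) \<and> 3 dvd x \<and> 3 dvd y" if S: "S \<in> ?bad" for S
  proof -
    obtain x y where xy: "S = hexagon (x, y)" "(x, y) \<in> hex_centres" "S \<subseteq> V"
      using S by (auto simp: hexagons_in_def)
    have "3 dvd x"
    proof (rule ccontr)
      assume "\<not> 3 dvd x"
      then have "3 \<le> card (S \<inter> M)"
        using good_hexagon[of x y M] partner_in_hexagon[of x y] M xy by blast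
      then show False using S by simp
    qed
    moreover from this have "3 dvd y"
      using xy(2) unfolding hex_centres_def by (simp; presburger)
    ultimately show ?thesis using xy by blast
  qed
  have finbad: "finite ?bad" using finite_hexagons_in[OF fin] by simp
  have four: "4 \<le> card (S - M)" if "S \<in> ?bad" for S
  proof -
    have S: "card S = 6" using that by (auto simp: hexagons_in_def card_hexagon)
    then have "finite S" by (auto intro: card_ge_0_finite)
    then have "card S = card (S - M) + card (S \<inter> M)"
      by (metis card_Int_Diff add.commute)
    then show ?thesis using S that by simp
  qed
  have "4 * card ?bad \<le> (\<Sum>S\<in>?bad. card (S - M))"
    using sum_mono[of ?bad "\<lambda>_. 4 :: nat"] four by (simp add: mult.commute)
  also have "\<dots> = card (\<Union>S\<in>?bad. S - M)"
  proof (rule card_UN_disjoint[symmetric])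
    show "\<forall>S\<in>?bad. finite (S - M)" by (auto simp: hexagons_in_def hexagon_def)
    show "\<forall>S\<in>?bad. \<forall>T\<in>?bad. S \<noteq> T \<longrightarrow> (S - M) \<inter> (T - M) = {}"
    proof (intro ballI impI)
      fix S T assume "S \<in> ?bad" "T \<in> ?bad" "S \<noteq> T"
      then have "S \<inter> T = {}"
        using bad[of S] bad[of T] hexagons_colour_0_disjoint by blast
      then show "(S - M) \<inter> (T - M) = {}" by blast
    qed
  qed (rule finbad)
  also have "\<dots> \<le> card (V - M)"
    using fin by (intro card_mono) (auto simp: hexagons_in_def)
  finally show ?thesis .
qed

lemma SC2_hex_game_ge:
  assumes fin: "finite V" and V: "V \<subseteq> hex_vertices"
  shows "3 / 4 * real (card (hexagons_in V)) - real (card (hex_boundary V)) / 8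
    \<le> real (SC2 (hex_game V) 3)"
proof -
  let ?H = "hexagons_in V" and ?G = "hex_game V"
  have G: "fst ?G = V" "snd ?G = ?H" by (simp_all add: hex_game_def)
  obtain P where P: "pairing ?G P" "\<forall>v\<in>V. partner v \<in> V \<longrightarrow> {v, partner v} \<in> P"
    using exists_hex_pairing[OF fin V] by blast
  obtain \<sigma> where \<sigma>: "pairing_strategy ?G P \<sigma>" using exists_pairing_strategy[OF P(1)] ..
  \<comment> \<open>Since \<open>SC2\<close> is a natural number, the real bound is rounded up; a
    negative bound becomes 0.\<close>
  let ?N = "nat \<lceil>3 / 4 * real (card ?H) - real (card (hex_boundary V)) / 8\<rceil>"
  have "?N \<le> SC2 ?G 3"
  proof (rule SC2_geI[OF _ _ P(1) \<sigma>])
    fix xs assume xs: "full_play ?G xs" "consistent \<sigma> xs"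
    let ?M = "maker_claims xs"
    let ?bad = "{S \<in> ?H. card (S \<inter> ?M) < 3}"
    have "v \<in> ?M \<or> partner v \<in> ?M" if "v \<in> V" "partner v \<in> V" for v
      using pairing_strategy_claims[OF \<sigma> xs] P(2) that partner_neq V G by (metis subsetD)
    then have "4 * card ?bad \<le> card (V - ?M)"
      by (rule card_bad_hexagons[OF fin])
    \<comment> \<open>Twice the vertices of Breaker are at most \<open>card V\<close>, which exceeds
      \<open>2 * card ?H\<close> by at most the boundary.\<close>
    then have "8 * card ?bad \<le> 2 * card ?H + card (hex_boundary V)"
      using card_breaker_claims[OF xs(1)] card_grid_le[OF fin V] G by simp
    moreover have "card ?H = num_good ?G 3 ?M + card ?bad"
    proof -
      have "?H = {S \<in> ?H. 3 \<le> card (S \<inter> ?M)} \<union> ?bad" by auto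
      also have "card \<dots> = card {S \<in> ?H. 3 \<le> card (S \<inter> ?M)} + card ?bad"
        using finite_hexagons_in[OF fin] by (intro card_Un_disjoint) auto
      finally show ?thesis by (simp add: num_good_def G)
    qed
    ultimately have "3 / 4 * real (card ?H) - real (card (hex_boundary V)) / 8 \<le> real (num_good ?G 3 ?M)"
      by linarith
    then show "?N \<le> num_good ?G 3 ?M" by linarith
  qed (use fin finite_hexagons_in G in auto)
  then show ?thesis by linarith
qed

theorem theorem19:
  fixes V :: "nat \<Rightarrow> (int \<times> int) set" and n :: "nat \<Rightarrow> nat"
  assumes grid: "\<And>m. finite (V m)" "\<And>m. V m \<subseteq> hex_vertices"
    and n_def: "\<And>m. n m = card (hexagons_in (V m))"
    and large: "filterlim n at_top sequentially"
    and small_boundary: "(\<lambda>m. real (card (hex_boundary (V m)))) \<in> o(\<lambda>m. real (n m))"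
  shows "\<exists>err. err \<in> o(\<lambda>m. real (n m)) \<and>
           (\<forall>m. 3 / 4 * real (n m) - err m \<le> real (SC2 (hex_game (V m)) 3))"
proof (intro exI conjI allI)
  \<comment> \<open>One eighth of the boundary is the error: the boundary bounds the excess of
    \<open>card V\<close>, Breaker gets at most half of the vertices, and spoiling a hexagon costs
    four.\<close>
  show "(\<lambda>m. real (card (hex_boundary (V m))) / 8) \<in> o(\<lambda>m. real (n m))"
    using small_boundary by simp
  show "3 / 4 * real (n m) - real (card (hex_boundary (V m))) / 8
    \<le> real (SC2 (hex_game (V m)) 3)" for m
    unfolding n_def using grid by (rule SC2_hex_game_ge)
qed

end
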